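(* Let $d\ge1$ be an integer and let $G=(V,E)$ be the Hamming hypercube with vertex set $V=\mathbb{Z}_2^d=\{0,1\}^d$. Then $N_{\varepsilon,p}(G)\sim\sqrt p$ for $2\le p\le d$, $N_{\varepsilon,p}(G)\sim d$ for $p\ge d2^d$, and $$\sqrt{d\,\frac{\ln p}{\ln\big(\frac{ed}{\ln p}\big)}}\ \lesssim\ N_{\varepsilon,p}(G)\ \lesssim\ \sqrt{d\ln p}\qquad\text{for }\max\{d,2\}\le p\le d2^d.$$ All implicit constants are universal (independent of $d$ and $p$).
   Context: The Hamming hypercube is the graph on $\{0,1\}^d$ in which two vertices are adjacent iff they differ in exactly one coordinate; $E$ is regarded as the (symmetric) set of ordered pairs of adjacent vertices, so $|E|=d2^d$. For a finite graph $G=(V,E)$ write $i\sim j$ when $(i,j)\in E$, and for $p\ge1$ put $$N_{\varepsilon,p}(G):=\sup_{\|s\|_2,\|t\|_2\le1}\Big\|\sum_{i,j\in V}\mathbf{1}_{i\sim j}\,\varepsilon_{ij}s_it_j\Big\|_p,$$ where $(\varepsilon_{ij})_{i,j\in V}$ are independent symmetric $\pm1$ random variables indexed by ordered pairs, the supremum is over $s,t\in\mathbb{R}^V$, $\|S\|_p=(\mathbb{E}|S|^p)^{1/p}$ for a random variable $S$, and $\|\cdot\|_2$ on vectors is the Euclidean norm. For nonnegative quantities, $f\lesssim g$ means $f\le Cg$ for an absolute constant $C$, and $f\sim g$ means $f\lesssim g$ and $g\lesssim f$. *)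

theory Defs
  imports "HOL-Probability.Probability" "HOL-Probability.Product_PMF"
begin

text \<open>The value outside \<open>V \<times> V\<close> is a dummy: all sums below range over \<open>V\<close>.\<close>

definition signs :: "'a set \<Rightarrow> ('a \<times> 'a \<Rightarrow> real) pmf" where
  "signs V = Pi_pmf (V \<times> V) 0 (\<lambda>_. pmf_of_set {-1, 1})"

definition moment_norm :: "real \<Rightarrow> 'b pmf \<Rightarrow> ('b \<Rightarrow> real) \<Rightarrow> real" where
  "moment_norm p M S = (measure_pmf.expectation M (\<lambda>\<omega>. \<bar>S \<omega>\<bar> powr p)) powr (1 / p)"

text \<open>
  Vectors in \<open>\<real>\<^sup>V\<close> are functions on \<open>'a\<close> whose values outside \<open>V\<close> are never used.
  For finite \<open>V\<close> and \<open>p \<ge> 1\<close> the supremum is over a nonempty set of reals bounded above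
  (by \<open>(card V)\<^sup>2\<close>, as all coordinates of \<open>s\<close> and \<open>t\<close> are at most 1 in absolute value),
  so the real-valued supremum is the true one.
\<close>

definition N_eps :: "'a set \<Rightarrow> ('a \<times> 'a) set \<Rightarrow> real \<Rightarrow> real" where
  "N_eps V E p =
     (SUP (s, t) \<in> {(s, t). L2_set s V \<le> 1 \<and> L2_set t V \<le> 1}.
        moment_norm p (signs V)
          (\<lambda>\<epsilon>. \<Sum>i\<in>V. \<Sum>j\<in>V. indicat_real E (i, j) * \<epsilon> (i, j) * s i * t j))"

definition cube_verts :: "nat \<Rightarrow> (nat \<Rightarrow> nat) set" where
  "cube_verts d = {..<d} \<rightarrow>\<^sub>E {0, 1}"

definition cube_edges :: "nat \<Rightarrow> ((nat \<Rightarrow> nat) \<times> (nat \<Rightarrow> nat)) set" where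
  "cube_edges d =
     {(x, y). x \<in> cube_verts d \<and> y \<in> cube_verts d \<and> card {k. k < d \<and> x k \<noteq> y k} = 1}"

definition N_cube :: "nat \<Rightarrow> real \<Rightarrow> real" where
  "N_cube d p = N_eps (cube_verts d) (cube_edges d) p"

end

theory Submission
  imports Defs
begin

text \<open>
  Upper bounds. The bilinear form is at most the norm \<open>d\<close> of the adjacency matrix, and Khintchine's
  inequality gives \<open>\<lesssim> \<surd>p\<close>. For \<open>\<surd>(d ln p)\<close>, let \<open>W\<close> be the set of vertices where \<open>s\<^sup>2\<close> or \<open>t\<^sup>2\<close> is at least
  \<open>1 / p\<close>, so that \<open>|W| \<le> 2 p\<close>. The coefficients outside \<open>W \<times> W\<close> have \<open>\<ell>\<^sub>2\<close>-norm \<open>\<le> \<surd>(2 d / p)\<close> and contribute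
  \<open>\<lesssim> \<surd>d\<close> by Khintchine. The edges inside \<open>W\<close> can be oriented with out-degrees at most \<open>log\<^sub>2 |W|\<close>, and
  by Cauchy--Schwarz a digraph with out-degrees \<open>\<le> a\<close> and in-degrees \<open>\<le> b\<close> has norm at most \<open>\<surd>(a b)\<close>.

  Lower bounds. If \<open>s\<close> and \<open>t\<close> are nonnegative and involve at most \<open>p\<close> edges, all these signs equal \<open>1\<close>
  with probability at least \<open>2\<^bsup>-p\<^esup>\<close>, so half of the deterministic form is a lower bound. Apply this to
  normalised indicators of the two sides of a biregular subgraph: a star, the whole cube, or the
  graph between two consecutive layers \<open>m - 1\<close> and \<open>m\<close>, which has \<open>m * (d choose m)\<close> edges and norm
  \<open>\<surd>(m (d - m + 1))\<close>, with \<open>m\<close> a small multiple of \<open>ln p / ln (e d / ln p)\<close>.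
\<close>

section \<open>Moments of Rademacher sums\<close>

lemma finite_set_signs: "finite V \<Longrightarrow> finite (set_pmf (signs V))"
  unfolding signs_def by (subst set_Pi_pmf) auto

lemma integrable_signs:
  fixes f :: "_ \<Rightarrow> real"
  shows "finite V \<Longrightarrow> integrable (measure_pmf (signs V)) f"
  by (rule integrable_measure_pmf_finite[OF finite_set_signs])

lemma abs_signs:
  assumes "finite V" "\<epsilon> \<in> set_pmf (signs V)" "e \<in> V \<times> V"
  shows "\<bar>\<epsilon> e\<bar> = 1"
proof -
  have "\<epsilon> e \<in> {-1, 1}"
    using assms unfolding signs_def by (subst (asm) set_Pi_pmf) (auto simp: PiE_dflt_def)
  thus ?thesis by auto
qed

lemma expectation_signs_mono:
  assumes "finite V" "\<And>\<epsilon>. \<epsilon> \<in> set_pmf (signs V) \<Longrightarrow> f \<epsilon> \<le> (g \<epsilon> :: real)"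
  shows "measure_pmf.expectation (signs V) f \<le> measure_pmf.expectation (signs V) g"
  using assms by (intro integral_mono_AE AE_pmfI integrable_signs) auto

lemma moment_norm_le_of_expectation:
  assumes "p > 0" "M \<ge> 0" "measure_pmf.expectation P (\<lambda>\<omega>. \<bar>S \<omega>\<bar> powr p) \<le> M powr p"
  shows "moment_norm p P S \<le> M"
proof -
  have "moment_norm p P S \<le> (M powr p) powr (1 / p)"
    unfolding moment_norm_def using assms by (intro powr_mono2) auto
  thus ?thesis using assms by (simp add: powr_powr)
qed

lemma moment_norm_ge_of_expectation:
  assumes "p > 0" "M \<ge> 0" "M powr p \<le> measure_pmf.expectation P (\<lambda>\<omega>. \<bar>S \<omega>\<bar> powr p)"
  shows "M \<le> moment_norm p P S"
proof -
  have "(M powr p) powr (1 / p) \<le> moment_norm p P S"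
    unfolding moment_norm_def using assms by (intro powr_mono2) auto
  thus ?thesis using assms by (simp add: powr_powr)
qed

lemma moment_norm_signs_le:
  assumes "finite V" "p > 0" "\<And>\<epsilon>. \<epsilon> \<in> set_pmf (signs V) \<Longrightarrow> \<bar>S \<epsilon>\<bar> \<le> B" "B \<ge> 0"
  shows "moment_norm p (signs V) S \<le> B"
proof (rule moment_norm_le_of_expectation)
  have "measure_pmf.expectation (signs V) (\<lambda>\<omega>. \<bar>S \<omega>\<bar> powr p)
      \<le> measure_pmf.expectation (signs V) (\<lambda>_. B powr p)"
    using assms by (intro expectation_signs_mono powr_mono2) auto
  thus "measure_pmf.expectation (signs V) (\<lambda>\<omega>. \<bar>S \<omega>\<bar> powr p) \<le> B powr p" by simp
qed (use assms in auto)

text \<open>Evenness reduces this to \<open>y \<ge> 0\<close>, where it is the inequality behind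
  Hoeffding's lemma for a fair coin, taken at \<open>2 * y\<close>.\<close>

lemma cosh_le_exp_square:
  fixes y :: real
  shows "(exp y + exp (- y)) / 2 \<le> exp (y\<^sup>2 / 2)"
proof -
  have *: "(exp y + exp (- y)) / 2 \<le> exp (y\<^sup>2 / 2)" if "y \<ge> 0" for y :: real
  proof -
    have pos: "1 + 1 / 2 * (exp (2 * y) - 1) > 0"
      using that by (simp add: add_pos_nonneg)
    have "- (2 * y) * (1 / 2) + ln (1 + 1 / 2 * (exp (2 * y) - 1)) \<le> (2 * y)\<^sup>2 / 8"
      using that by (intro Hoeffdings_lemma_aux) auto
    hence "exp (- y + ln (1 + 1 / 2 * (exp (2 * y) - 1))) \<le> exp (y\<^sup>2 / 2)"
      by (simp add: power2_eq_square)
    also have "exp (- y + ln (1 + 1 / 2 * (exp (2 * y) - 1))) = exp (- y) * ((1 + exp (2 * y)) / 2)"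
      using pos by (simp only: exp_add exp_ln) (simp add: field_simps)
    also have "\<dots> = (exp (- y) + exp (- y + 2 * y)) / 2"
      by (simp only: exp_add) (simp add: field_simps)
    finally show ?thesis by (simp add: add.commute)
  qed
  show ?thesis
    using *[of y] *[of "- y"] by (cases "y \<ge> 0") (auto simp: add.commute)
qed

text \<open>Independence factors the expectation over pairs, each factor is a hyperbolic cosine, and
  the exponents add up: the sum is subgaussian with variance proxy
  \<open>\<sigma>\<^sup>2\<close>.\<close>

lemma mgf_signs_le:
  assumes V: "finite V" and c: "(\<Sum>e\<in>V \<times> V. (c e)\<^sup>2) \<le> \<sigma>\<^sup>2"
  shows "measure_pmf.expectation (signs V) (\<lambda>\<epsilon>. exp (l * (\<Sum>e\<in>V \<times> V. c e * \<epsilon> e)))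
     \<le> exp (l\<^sup>2 * \<sigma>\<^sup>2 / 2)"
proof -
  have "measure_pmf.expectation (signs V) (\<lambda>\<epsilon>. exp (l * (\<Sum>e\<in>V \<times> V. c e * \<epsilon> e)))
      = measure_pmf.expectation (signs V) (\<lambda>\<epsilon>. \<Prod>e\<in>V \<times> V. exp (l * c e * \<epsilon> e))"
    using V by (simp add: exp_sum sum_distrib_left mult.assoc)
  also have "\<dots> = (\<Prod>e\<in>V \<times> V. measure_pmf.expectation (pmf_of_set {-1, 1}) (\<lambda>v. exp (l * c e * v)))"
    unfolding signs_def using V
    by (subst expectation_prod_Pi_pmf) (auto intro!: integrable_measure_pmf_finite)
  also have "\<dots> = (\<Prod>e\<in>V \<times> V. (exp (l * c e) + exp (- (l * c e))) / 2)"
    by (intro prod.cong refl, subst integral_pmf_of_set) auto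
  also have "\<dots> \<le> (\<Prod>e\<in>V \<times> V. exp ((l * c e)\<^sup>2 / 2))"
    by (intro prod_mono conjI cosh_le_exp_square) (auto intro!: add_nonneg_nonneg)
  also have "\<dots> = exp (l\<^sup>2 / 2 * (\<Sum>e\<in>V \<times> V. (c e)\<^sup>2))"
    using V by (simp add: exp_sum sum_distrib_left power_mult_distrib)
  also have "\<dots> \<le> exp (l\<^sup>2 * \<sigma>\<^sup>2 / 2)"
    using mult_left_mono[OF c, of "l\<^sup>2 / 2"] by simp
  finally show ?thesis .
qed

text \<open>As a function of \<open>x\<close>, \<open>x powr p * exp (- l * x)\<close> is largest at
  \<open>x = p / l\<close>; this follows from \<open>1 + u \<le> exp u\<close> with
  \<open>u = l * x / p - 1\<close>. It turns exponential moments into power moments.\<close>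

lemma powr_le_exp:
  fixes x p k :: real
  assumes "x \<ge> 0" "p > 0" "l > 0"
  shows "x powr p \<le> (p / l) powr p * exp (l * x - p)"
proof -
  have "l * x / p \<le> exp (l * x / p - 1)"
    using exp_ge_add_one_self[of "l * x / p - 1"] by simp
  hence "x \<le> p / l * exp (l * x / p - 1)"
    using assms by (simp add: field_simps)
  hence "x powr p \<le> (p / l * exp (l * x / p - 1)) powr p"
    using assms by (intro powr_mono2) auto
  also have "\<dots> = (p / l) powr p * exp (l * x - p)"
    using assms
    by (subst powr_mult) (auto simp: powr_def[of "exp _"] right_diff_distrib simp del: times_divide_eq_left)
  finally show ?thesis .
qed

lemma khintchine_signs:
  assumes V: "finite V" and p: "p > 0" and \<sigma>: "\<sigma> > 0"
    and c: "(\<Sum>e\<in>V \<times> V. (c e)\<^sup>2) \<le> \<sigma>\<^sup>2"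
  shows "measure_pmf.expectation (signs V) (\<lambda>\<epsilon>. \<bar>\<Sum>e\<in>V \<times> V. c e * \<epsilon> e\<bar> powr p)
     \<le> 2 * (sqrt p * \<sigma>) powr p"
proof -
  \<comment> \<open>The minimiser of
    \<open>(p / l) powr p * exp (l\<^sup>2 * \<sigma>\<^sup>2 / 2)\<close>.\<close>
  define l where "l = sqrt p / \<sigma>"
  let ?X = "\<lambda>\<epsilon>. \<Sum>e\<in>V \<times> V. c e * \<epsilon> e"
  have l: "l > 0" using p \<sigma> by (simp add: l_def)
  have pl: "p / l = sqrt p * \<sigma>" using p \<sigma> by (simp add: l_def field_simps)
  have l2: "l\<^sup>2 * \<sigma>\<^sup>2 = p" using p \<sigma> by (simp add: l_def power_divide)
  have "measure_pmf.expectation (signs V) (\<lambda>\<epsilon>. \<bar>?X \<epsilon>\<bar> powr p)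
      \<le> measure_pmf.expectation (signs V)
          (\<lambda>\<epsilon>. (p / l) powr p * exp (- p) * (exp (l * ?X \<epsilon>) + exp (- l * ?X \<epsilon>)))"
  proof (rule expectation_signs_mono[OF V])
    fix \<epsilon>
    have "\<bar>?X \<epsilon>\<bar> powr p \<le> (p / l) powr p * exp (l * \<bar>?X \<epsilon>\<bar> - p)"
      using p l by (intro powr_le_exp) auto
    also have "\<dots> = (p / l) powr p * exp (- p) * exp (l * \<bar>?X \<epsilon>\<bar>)"
      by (simp add: exp_diff exp_minus field_simps)
    also have "\<dots> \<le> (p / l) powr p * exp (- p) * (exp (l * ?X \<epsilon>) + exp (- l * ?X \<epsilon>))"
      by (intro mult_left_mono) (auto simp: abs_if)
    finally show "\<bar>?X \<epsilon>\<bar> powr p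
        \<le> (p / l) powr p * exp (- p) * (exp (l * ?X \<epsilon>) + exp (- l * ?X \<epsilon>))" .
  qed
  also have "\<dots> = (p / l) powr p * exp (- p) *
      (measure_pmf.expectation (signs V) (\<lambda>\<epsilon>. exp (l * ?X \<epsilon>)) +
       measure_pmf.expectation (signs V) (\<lambda>\<epsilon>. exp (- l * ?X \<epsilon>)))"
    by (subst Bochner_Integration.integral_add[symmetric]) (auto intro!: integrable_signs[OF V])
  also have "\<dots> \<le> (p / l) powr p * exp (- p) * (exp (l\<^sup>2 * \<sigma>\<^sup>2 / 2) + exp ((- l)\<^sup>2 * \<sigma>\<^sup>2 / 2))"
    by (intro mult_left_mono add_mono mgf_signs_le[OF V c]) auto
  also have "\<dots> = 2 * (p / l) powr p * exp (- p / 2)"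
    by (simp add: l2 exp_add[symmetric])
  also have "\<dots> \<le> 2 * (p / l) powr p * 1"
    using p by (intro mult_left_mono) auto
  finally show ?thesis by (simp add: pl)
qed

text \<open>A substitute for Minkowski's inequality when \<open>S\<close> is a part bounded by
  \<open>B\<close> plus a Rademacher sum: pointwise \<open>\<bar>S\<bar>\<close> is at most twice
  the larger of the two, and the \<open>p\<close>-th power of a maximum is at most the sum of the
  \<open>p\<close>-th powers.\<close>

lemma moment_norm_split_le:
  assumes V: "finite V" and p: "p \<ge> 1" and \<sigma>: "\<sigma> > 0" and B: "B \<ge> 0"
    and S: "\<And>\<epsilon>. \<epsilon> \<in> set_pmf (signs V) \<Longrightarrow> \<bar>S \<epsilon> - (\<Sum>e\<in>V \<times> V. c e * \<epsilon> e)\<bar> \<le> B"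
    and c: "(\<Sum>e\<in>V \<times> V. (c e)\<^sup>2) \<le> \<sigma>\<^sup>2"
  shows "moment_norm p (signs V) S \<le> 6 * (B + sqrt p * \<sigma>)"
proof (rule moment_norm_le_of_expectation)
  let ?X = "\<lambda>\<epsilon>. \<Sum>e\<in>V \<times> V. c e * \<epsilon> e"
  define M where "M = B + sqrt p * \<sigma>"
  have M: "M > 0" "B \<le> M" "sqrt p * \<sigma> \<le> M"
    using p \<sigma> B by (auto simp: M_def intro!: add_nonneg_pos)
  have "measure_pmf.expectation (signs V) (\<lambda>\<epsilon>. \<bar>S \<epsilon>\<bar> powr p)
      \<le> measure_pmf.expectation (signs V) (\<lambda>\<epsilon>. 2 powr p * (B powr p + \<bar>?X \<epsilon>\<bar> powr p))"
  proof (rule expectation_signs_mono[OF V])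
    fix \<epsilon> assume "\<epsilon> \<in> set_pmf (signs V)"
    from S[OF this] have "\<bar>S \<epsilon>\<bar> \<le> 2 * max B \<bar>?X \<epsilon>\<bar>" by linarith
    hence "\<bar>S \<epsilon>\<bar> powr p \<le> (2 * max B \<bar>?X \<epsilon>\<bar>) powr p"
      using p by (intro powr_mono2) auto
    also have "\<dots> = 2 powr p * (max B \<bar>?X \<epsilon>\<bar>) powr p" using B by (simp add: powr_mult)
    also have "\<dots> \<le> 2 powr p * (B powr p + \<bar>?X \<epsilon>\<bar> powr p)"
      by (intro mult_left_mono) (auto simp: max_def)
    finally show "\<bar>S \<epsilon>\<bar> powr p \<le> 2 powr p * (B powr p + \<bar>?X \<epsilon>\<bar> powr p)" .
  qed
  also have "\<dots> = 2 powr p * (B powr p + measure_pmf.expectation (signs V) (\<lambda>\<epsilon>. \<bar>?X \<epsilon>\<bar> powr p))"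
    by (simp add: Bochner_Integration.integral_add integrable_signs[OF V])
  also have "\<dots> \<le> 2 powr p * (M powr p + 2 * M powr p)"
  proof (intro mult_left_mono add_mono)
    show "B powr p \<le> M powr p" using M B p by (intro powr_mono2) auto
    have "measure_pmf.expectation (signs V) (\<lambda>\<epsilon>. \<bar>?X \<epsilon>\<bar> powr p) \<le> 2 * (sqrt p * \<sigma>) powr p"
      using V p \<sigma> c by (intro khintchine_signs) auto
    also have "\<dots> \<le> 2 * M powr p" using M \<sigma> p by (intro mult_left_mono powr_mono2) auto
    finally show "measure_pmf.expectation (signs V) (\<lambda>\<epsilon>. \<bar>?X \<epsilon>\<bar> powr p) \<le> 2 * M powr p" .
  qed auto
  \<comment> \<open>Since \<open>p \<ge> 1\<close>, the factor 3 is at most \<open>3 powr p\<close>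
    and can be moved under the \<open>p\<close>-th power; this yields the constant 6.\<close>
  also have "\<dots> = 2 powr p * 3 powr 1 * M powr p" by simp
  also have "\<dots> \<le> 2 powr p * 3 powr p * M powr p"
    using p by (intro mult_right_mono mult_left_mono powr_mono) auto
  also have "\<dots> = (6 * M) powr p" using M by (simp add: powr_mult[symmetric])
  finally show "measure_pmf.expectation (signs V) (\<lambda>\<epsilon>. \<bar>S \<epsilon>\<bar> powr p)
      \<le> (6 * (B + sqrt p * \<sigma>)) powr p" by (simp add: M_def)
qed (use p \<sigma> B in auto)

text \<open>With probability \<open>2 powr - card F \<ge> 2 powr - p\<close> all signs on \<open>F\<close> are \<open>1\<close>, and taking
  the \<open>p\<close>-th root of this probability costs only a factor \<open>2\<close>.\<close>

lemma moment_norm_signs_ge: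
  assumes V: "finite V" and p: "p > 0" and F: "F \<subseteq> V \<times> V" "real (card F) \<le> p"
    and v: "v \<ge> 0" and S: "\<And>\<epsilon>. (\<And>e. e \<in> F \<Longrightarrow> \<epsilon> e = 1) \<Longrightarrow> S \<epsilon> = v"
  shows "v / 2 \<le> moment_norm p (signs V) S"
proof (rule moment_norm_ge_of_expectation)
  \<comment> \<open>The event that all signs on \<open>F\<close> are 1. Its default value 0 agrees
    with the one in \<open>signs\<close>, so its probability is a product over
    \<open>V \<times> V\<close>.\<close>
  define D where "D = PiE_dflt (V \<times> V) (0::real) (\<lambda>e. if e \<in> F then {1} else UNIV)"
  have fF: "finite F" using F V by (meson finite_SigmaI finite_subset)
  have "measure_pmf.prob (signs V) D
      = (\<Prod>e\<in>V \<times> V. measure_pmf.prob (pmf_of_set {-1, 1::real}) (if e \<in> F then {1} else UNIV))"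
    unfolding signs_def D_def using V by (subst measure_Pi_pmf_PiE_dflt) auto
  also have "\<dots> = (\<Prod>e\<in>V \<times> V. if e \<in> F then 1 / 2 else 1)"
    by (intro prod.cong refl) (auto simp: measure_pmf_single)
  also have "\<dots> = (\<Prod>e\<in>F. 1 / 2)"
    using V F by (intro prod.mono_neutral_cong_right) auto
  also have "\<dots> = (1 / 2) powr real (card F)" by (simp add: powr_realpow)
  finally have prob: "measure_pmf.prob (signs V) D = (1 / 2) powr real (card F)" .
  have "(v / 2) powr p = (1 / 2) powr p * v powr p" using v by (simp add: powr_divide)
  also have "\<dots> \<le> (1 / 2) powr real (card F) * v powr p"
    using F by (intro mult_right_mono powr_mono') auto
  also have "\<dots> = measure_pmf.expectation (signs V) (\<lambda>\<epsilon>. indicat_real D \<epsilon> * v powr p)"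
    using prob by simp
  also have "\<dots> \<le> measure_pmf.expectation (signs V) (\<lambda>\<epsilon>. \<bar>S \<epsilon>\<bar> powr p)"
  proof (rule expectation_signs_mono[OF V])
    fix \<epsilon>
    have "S \<epsilon> = v" if "\<epsilon> \<in> D"
    proof (rule S)
      fix e assume "e \<in> F"
      with that F show "\<epsilon> e = 1" by (force simp: D_def PiE_dflt_def)
    qed
    thus "indicat_real D \<epsilon> * v powr p \<le> \<bar>S \<epsilon>\<bar> powr p"
      using v by (auto simp: indicator_def)
  qed
  finally show "(v / 2) powr p \<le> measure_pmf.expectation (signs V) (\<lambda>\<epsilon>. \<bar>S \<epsilon>\<bar> powr p)" .
qed (use p v in auto)

section \<open>Degree bounds and orientations of subgraphs of the cube\<close>

lemma sum_fst_le:
  fixes f :: "'a \<Rightarrow> real"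
  assumes V: "finite V" and R: "R \<subseteq> V \<times> V" and f: "\<And>i. i \<in> V \<Longrightarrow> f i \<ge> 0"
    and deg: "\<And>i. i \<in> V \<Longrightarrow> real (card (R `` {i})) \<le> \<alpha>"
  shows "(\<Sum>e\<in>R. f (fst e)) \<le> \<alpha> * (\<Sum>i\<in>V. f i)"
proof -
  have fin: "finite (R `` {i})" for i
    using R V by (auto intro: finite_subset[of _ V])
  have "R = Sigma V (\<lambda>i. R `` {i})" using R by auto
  hence "(\<Sum>e\<in>R. f (fst e)) = (\<Sum>e\<in>Sigma V (\<lambda>i. R `` {i}). f (fst e))" by simp
  also have "\<dots> = (\<Sum>i\<in>V. \<Sum>j\<in>R `` {i}. f i)"
    using V fin by (subst sum.Sigma) (auto intro!: sum.cong)
  also have "\<dots> = (\<Sum>i\<in>V. real (card (R `` {i})) * f i)" by simp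
  also have "\<dots> \<le> (\<Sum>i\<in>V. \<alpha> * f i)" using deg f by (intro sum_mono mult_right_mono) auto
  finally show ?thesis by (simp add: sum_distrib_left)
qed

lemma sum_snd_le:
  fixes f :: "'a \<Rightarrow> real"
  assumes V: "finite V" and R: "R \<subseteq> V \<times> V" and f: "\<And>j. j \<in> V \<Longrightarrow> f j \<ge> 0"
    and deg: "\<And>j. j \<in> V \<Longrightarrow> real (card (R\<inverse> `` {j})) \<le> \<beta>"
  shows "(\<Sum>e\<in>R. f (snd e)) \<le> \<beta> * (\<Sum>j\<in>V. f j)"
proof -
  have "(\<Sum>e\<in>R. f (snd e)) = (\<Sum>e\<in>R\<inverse>. f (fst e))"
    by (rule sum.reindex_bij_witness[of _ prod.swap prod.swap]) auto
  also have "\<dots> \<le> \<beta> * (\<Sum>j\<in>V. f j)"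
    using R by (intro sum_fst_le V f deg) auto
  finally show ?thesis .
qed

text \<open>Cauchy-Schwarz over the edges of \<open>R\<close>: each \<open>(s i)\<^sup>2\<close> is
  counted once per outgoing edge and each \<open>(t j)\<^sup>2\<close> once per incoming
  edge.\<close>

lemma sum_le_sqrt_degrees:
  fixes s t :: "'a \<Rightarrow> real"
  assumes V: "finite V" and R: "R \<subseteq> V \<times> V"
    and out: "\<And>i. i \<in> V \<Longrightarrow> real (card (R `` {i})) \<le> \<alpha>"
    and inn: "\<And>j. j \<in> V \<Longrightarrow> real (card (R\<inverse> `` {j})) \<le> \<beta>"
    and \<alpha>: "\<alpha> \<ge> 0" and \<beta>: "\<beta> \<ge> 0"
    and s: "(\<Sum>i\<in>V. (s i)\<^sup>2) \<le> 1" and t: "(\<Sum>j\<in>V. (t j)\<^sup>2) \<le> 1"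
  shows "(\<Sum>e\<in>R. \<bar>s (fst e) * t (snd e)\<bar>) \<le> sqrt (\<alpha> * \<beta>)"
proof -
  have "(\<Sum>e\<in>R. (s (fst e))\<^sup>2) \<le> \<alpha> * (\<Sum>i\<in>V. (s i)\<^sup>2)"
    using V R out by (intro sum_fst_le) auto
  also have "\<dots> \<le> \<alpha>" using s \<alpha> mult_left_mono[of _ 1 \<alpha>] by simp
  finally have 1: "L2_set (\<lambda>e. s (fst e)) R \<le> sqrt \<alpha>" by (simp add: L2_set_def)
  have "(\<Sum>e\<in>R. (t (snd e))\<^sup>2) \<le> \<beta> * (\<Sum>j\<in>V. (t j)\<^sup>2)"
    using V R inn by (intro sum_snd_le) auto
  also have "\<dots> \<le> \<beta>" using t \<beta> mult_left_mono[of _ 1 \<beta>] by simp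
  finally have 2: "L2_set (\<lambda>e. t (snd e)) R \<le> sqrt \<beta>" by (simp add: L2_set_def)
  have "(\<Sum>e\<in>R. \<bar>s (fst e) * t (snd e)\<bar>) \<le> L2_set (\<lambda>e. s (fst e)) R * L2_set (\<lambda>e. t (snd e)) R"
    unfolding abs_mult by (rule L2_set_mult_ineq)
  also have "\<dots> \<le> sqrt \<alpha> * sqrt \<beta>" using 1 2 \<alpha> by (intro mult_mono) (auto simp: L2_set_nonneg)
  finally show ?thesis by (simp add: real_sqrt_mult)
qed

section \<open>The cube graph in terms of coordinate flips\<close>

definition flip :: "nat \<Rightarrow> (nat \<Rightarrow> nat) \<Rightarrow> nat \<Rightarrow> nat" where
  "flip k x = x(k := 1 - x k)"

lemma finite_cube_verts: "finite (cube_verts d)"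
  unfolding cube_verts_def by (intro finite_PiE) auto

lemma card_cube_verts: "card (cube_verts d) = 2 ^ d"
  unfolding cube_verts_def by (subst card_PiE) (auto simp: numeral_2_eq_2)

lemma cube_verts_cases: "x \<in> cube_verts d \<Longrightarrow> k < d \<Longrightarrow> x k = 0 \<or> x k = 1"
  unfolding cube_verts_def by (auto dest: PiE_mem)

lemma flip_in_cube_verts: "x \<in> cube_verts d \<Longrightarrow> k < d \<Longrightarrow> flip k x \<in> cube_verts d"
  unfolding cube_verts_def flip_def by (auto simp: PiE_iff extensional_def)

text \<open>Coordinates are natural numbers, so \<open>1 - (1 - a) = a\<close> rests on
  \<open>a\<close> being 0 or 1.\<close>

lemma flip_flip: "x \<in> cube_verts d \<Longrightarrow> k < d \<Longrightarrow> flip k (flip k x) = x"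
  using cube_verts_cases[of x d k] by (auto simp: flip_def fun_eq_iff)

lemma flip_neq: "x \<in> cube_verts d \<Longrightarrow> k < d \<Longrightarrow> flip k x k \<noteq> x k"
  using cube_verts_cases[of x d k] by (auto simp: flip_def)

lemma cube_verts_eqI:
  "x \<in> cube_verts d \<Longrightarrow> y \<in> cube_verts d \<Longrightarrow> (\<And>k. k < d \<Longrightarrow> x k = y k) \<Longrightarrow> x = y"
  unfolding cube_verts_def by (rule PiE_ext) auto

text \<open>Trades Hamming distance for a parametrisation of the neighbours of \<open>x\<close> by
  coordinates, from which degrees can be read off.\<close>

lemma cube_edges_iff:
  "(x, y) \<in> cube_edges d \<longleftrightarrow> x \<in> cube_verts d \<and> (\<exists>k<d. y = flip k x)"
proof
  assume "(x, y) \<in> cube_edges d"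
  hence x: "x \<in> cube_verts d" and y: "y \<in> cube_verts d" and "card {k. k < d \<and> x k \<noteq> y k} = 1"
    by (auto simp: cube_edges_def)
  then obtain k where k: "{k. k < d \<and> x k \<noteq> y k} = {k}" by (meson card_1_singletonE)
  hence kd: "k < d" by blast
  have *: "x l \<noteq> y l \<longleftrightarrow> l = k" if "l < d" for l
    using k that by blast
  have "y = flip k x"
  proof (rule cube_verts_eqI[OF y flip_in_cube_verts[OF x kd]])
    fix l assume "l < d"
    thus "y l = flip k x l"
      using *[of l] cube_verts_cases[OF x, of l] cube_verts_cases[OF y, of l]
      by (cases "l = k") (auto simp: flip_def)
  qed
  thus "x \<in> cube_verts d \<and> (\<exists>k<d. y = flip k x)" using x kd by auto
next
  assume "x \<in> cube_verts d \<and> (\<exists>k<d. y = flip k x)"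
  then obtain k where x: "x \<in> cube_verts d" and k: "k < d" and y: "y = flip k x" by auto
  have "{l. l < d \<and> x l \<noteq> y l} = {k}"
    using flip_neq[OF x k] k by (auto simp: y flip_def)
  thus "(x, y) \<in> cube_edges d"
    using x flip_in_cube_verts[OF x k] by (auto simp: cube_edges_def y)
qed

lemma cube_edges_subset: "cube_edges d \<subseteq> cube_verts d \<times> cube_verts d"
  by (auto simp: cube_edges_def)

lemma sym_cube_edges: "sym (cube_edges d)"
  unfolding sym_def cube_edges_iff by (metis flip_flip flip_in_cube_verts)

lemma converse_cube_edges: "(cube_edges d)\<inverse> = cube_edges d"
  using sym_cube_edges by (simp add: sym_conv_converse_eq)

lemma inj_flip:
  assumes "x \<in> cube_verts d" shows "inj_on (\<lambda>k. flip k x) {..<d}"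
proof (rule inj_onI, rule ccontr)
  fix k l assume "k \<in> {..<d}" "l \<in> {..<d}" and eq: "flip k x = flip l x" and "k \<noteq> l"
  have "flip k x k = flip l x k" using eq by simp
  also have "\<dots> = x k" using \<open>k \<noteq> l\<close> by (simp add: flip_def)
  finally show False using flip_neq[OF assms] \<open>k \<in> {..<d}\<close> by auto
qed

lemma card_cube_neighbours:
  assumes "x \<in> cube_verts d"
  shows "card (cube_edges d `` {x}) = d"
proof -
  have "cube_edges d `` {x} = (\<lambda>k. flip k x) ` {..<d}"
    using assms by (auto simp: cube_edges_iff)
  thus ?thesis using inj_flip[OF assms] by (simp add: card_image)
qed

text \<open>Split \<open>S\<close> along a coordinate on which it is not constant and direct the edges between the
  two halves from the smaller to the larger one: out-degrees in the smaller half, whose size is at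
  most half of that of \<open>S\<close>, increase by at most one.\<close>

lemma cube_orientation:
  assumes "S \<subseteq> cube_verts d"
  shows "\<exists>R\<subseteq>cube_edges d \<inter> S \<times> S. cube_edges d \<inter> S \<times> S \<subseteq> R \<union> R\<inverse> \<and>
     (\<forall>x\<in>S. 2 ^ card (R `` {x}) \<le> card S)"
  using assms
proof (induction "card S" arbitrary: S rule: less_induct)
  case less
  have finS: "finite S" using less.prems finite_cube_verts finite_subset by blast
  show ?case
  proof (cases "\<exists>x\<in>S. \<exists>y\<in>S. x \<noteq> y")
    case False
    have "x \<noteq> y" if "(x, y) \<in> cube_edges d" for x y
      using that by (auto simp: cube_edges_def)
    hence "cube_edges d \<inter> S \<times> S = {}" using False by blast
    moreover have "1 \<le> card S" if "x \<in> S" for x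
      using that finS by (metis One_nat_def Suc_leI card_gt_0_iff empty_iff)
    ultimately show ?thesis by (intro exI[of _ "{}"]) auto
  next
    case True
    then obtain x y where xy: "x \<in> S" "y \<in> S" "x \<noteq> y" by auto
    then obtain k where k: "k < d" "x k \<noteq> y k"
      using cube_verts_eqI less.prems by blast
    \<comment> \<open>Both values occur at coordinate \<open>k\<close>, and \<open>a\<close> is the
      one taken on the smaller half. Nonemptiness of both halves makes them proper subsets of
      \<open>S\<close>, so that the induction hypothesis applies.\<close>
    have "\<exists>a. card {z\<in>S. z k = a} \<le> card {z\<in>S. z k \<noteq> a} \<and> {z\<in>S. z k = a} \<noteq> {} \<and> {z\<in>S. z k \<noteq> a} \<noteq> {}"
    proof -
      have bin: "z k = 0 \<or> z k = 1" if "z \<in> S" for z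
        using that k less.prems cube_verts_cases by blast
      have "z k \<noteq> x k \<longleftrightarrow> z k = y k" if "z \<in> S" for z
        using bin[OF that] bin[OF xy(1)] bin[OF xy(2)] k by auto
      hence 1: "{z\<in>S. z k \<noteq> x k} = {z\<in>S. z k = y k}" and 2: "{z\<in>S. z k \<noteq> y k} = {z\<in>S. z k = x k}"
        by (blast, blast)
      have "card {z\<in>S. z k = x k} \<le> card {z\<in>S. z k = y k} \<or> card {z\<in>S. z k = y k} \<le> card {z\<in>S. z k = x k}"
        by linarith
      thus ?thesis
      proof
        assume "card {z\<in>S. z k = x k} \<le> card {z\<in>S. z k = y k}"
        thus ?thesis using xy by (intro exI[of _ "x k"]) (auto simp: 1)
      next
        assume "card {z\<in>S. z k = y k} \<le> card {z\<in>S. z k = x k}"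
        thus ?thesis using xy by (intro exI[of _ "y k"]) (auto simp: 2)
      qed
    qed
    then obtain a where a: "card {z\<in>S. z k = a} \<le> card {z\<in>S. z k \<noteq> a}"
      "{z\<in>S. z k = a} \<noteq> {}" "{z\<in>S. z k \<noteq> a} \<noteq> {}" by blast
    define A where "A = {z\<in>S. z k = a}"
    define B where "B = {z\<in>S. z k \<noteq> a}"
    have AB: "S = A \<union> B" "A \<inter> B = {}" by (auto simp: A_def B_def)
    have fin: "finite A" "finite B" using finS AB by auto
    have cS: "card S = card A + card B" using AB fin by (simp add: card_Un_disjoint)
    have pos: "card A > 0" "card B > 0" using a fin by (auto simp: A_def B_def card_gt_0_iff)
    have cAB: "card A \<le> card B" using a by (simp add: A_def B_def)
    obtain RA where RA: "RA \<subseteq> cube_edges d \<inter> A \<times> A" "cube_edges d \<inter> A \<times> A \<subseteq> RA \<union> RA\<inverse>"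
      "\<And>x. x \<in> A \<Longrightarrow> 2 ^ card (RA `` {x}) \<le> card A"
      using less.hyps[of A] cS pos less.prems AB by auto
    obtain RB where RB: "RB \<subseteq> cube_edges d \<inter> B \<times> B" "cube_edges d \<inter> B \<times> B \<subseteq> RB \<union> RB\<inverse>"
      "\<And>x. x \<in> B \<Longrightarrow> 2 ^ card (RB `` {x}) \<le> card B"
      using less.hyps[of B] cS pos less.prems AB by auto
    define R where "R = RA \<union> RB \<union> (cube_edges d \<inter> A \<times> B)"
    have "R \<subseteq> cube_edges d \<inter> S \<times> S" using RA RB AB by (auto simp: R_def)
    moreover have "cube_edges d \<inter> S \<times> S \<subseteq> R \<union> R\<inverse>"
    proof
      fix e assume e: "e \<in> cube_edges d \<inter> S \<times> S"
      obtain u v where uv: "e = (u, v)" by (cases e)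
      have "(v, u) \<in> cube_edges d" using e sym_cube_edges[of d] by (auto simp: uv sym_def)
      thus "e \<in> R \<union> R\<inverse>"
        using e RA(2) RB(2) AB(1) by (auto simp: uv R_def)
    qed
    moreover have "2 ^ card (R `` {x}) \<le> card S" if "x \<in> S" for x
    proof (cases "x \<in> A")
      case True
      have "R `` {x} \<subseteq> insert (flip k x) (RA `` {x})"
      proof
        fix y assume "y \<in> R `` {x}"
        hence "y \<in> RA `` {x} \<or> (x, y) \<in> cube_edges d \<and> y \<in> B"
          using True RB AB by (auto simp: R_def)
        \<comment> \<open>An edge between the halves must change coordinate \<open>k\<close>, so
          \<open>x\<close> has at most one neighbour across.\<close>
        moreover have "y = flip k x" if "(x, y) \<in> cube_edges d" "y \<in> B"
        proof -
          obtain l where l: "y = flip l x" using \<open>(x, y) \<in> cube_edges d\<close> by (auto simp: cube_edges_iff)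
          have "x k \<noteq> y k" using True that by (auto simp: A_def B_def)
          hence "l = k" by (auto simp: l flip_def split: if_splits)
          thus ?thesis by (simp add: l)
        qed
        ultimately show "y \<in> insert (flip k x) (RA `` {x})" by blast
      qed
      moreover have "finite (RA `` {x})" using RA fin by (auto intro: finite_subset[of _ A])
      ultimately have "card (R `` {x}) \<le> card (insert (flip k x) (RA `` {x}))"
        by (intro card_mono) auto
      also have "\<dots> \<le> Suc (card (RA `` {x}))"
        using \<open>finite (RA `` {x})\<close> by (simp add: card_insert_if)
      finally have "card (R `` {x}) \<le> Suc (card (RA `` {x}))" .
      \<comment> \<open>The additional edge doubles the power of two, and
        \<open>2 * card A \<le> card S\<close> pays for it.\<close>
      hence "2 ^ card (R `` {x}) \<le> (2 ^ Suc (card (RA `` {x})) :: nat)" by (intro power_increasing) auto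
      also have "\<dots> \<le> 2 * card A" using RA(3)[OF True] by simp
      finally show ?thesis using cS cAB by simp
    next
      case False
      hence "x \<in> B" using that AB by auto
      moreover have "R `` {x} = RB `` {x}" using False RA by (auto simp: R_def)
      ultimately show ?thesis using RB(3)[of x] cS by simp
    qed
    ultimately show ?thesis by blast
  qed
qed

section \<open>Biregular subgraphs and upper bounds\<close>

lemma edge_sum_eq:
  "(\<Sum>i\<in>V. \<Sum>j\<in>V. indicat_real E (i, j) * \<epsilon> (i, j) * s i * t j)
    = (\<Sum>e\<in>V \<times> V. indicat_real E e * (s (fst e) * t (snd e)) * \<epsilon> e)"
  by (simp add: sum.cartesian_product case_prod_unfold mult_ac)

lemma sum_indicator_signs_le:
  assumes "finite V" "\<epsilon> \<in> set_pmf (signs V)" "R \<subseteq> V \<times> V"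
  shows "\<bar>\<Sum>e\<in>V \<times> V. indicat_real R e * (s (fst e) * t (snd e)) * \<epsilon> e\<bar>
    \<le> (\<Sum>e\<in>R. \<bar>s (fst e) * t (snd e)\<bar>)"
proof -
  have "\<bar>\<Sum>e\<in>V \<times> V. indicat_real R e * (s (fst e) * t (snd e)) * \<epsilon> e\<bar>
      \<le> (\<Sum>e\<in>V \<times> V. \<bar>indicat_real R e * (s (fst e) * t (snd e)) * \<epsilon> e\<bar>)"
    by (rule sum_abs)
  also have "\<dots> = (\<Sum>e\<in>V \<times> V. indicat_real R e * \<bar>s (fst e) * t (snd e)\<bar>)"
    using abs_signs[OF assms(1,2)] by (intro sum.cong refl) (simp add: abs_mult)
  also have "\<dots> = (\<Sum>e\<in>R. \<bar>s (fst e) * t (snd e)\<bar>)"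
    using assms by (intro sum.mono_neutral_cong_right) (auto simp: indicator_def)
  finally show ?thesis .
qed

lemma L2_set_le_1_iff: "L2_set s V \<le> 1 \<longleftrightarrow> (\<Sum>i\<in>V. (s i)\<^sup>2) \<le> 1"
  by (simp add: L2_set_def)

lemma N_eps_leI:
  assumes "\<And>s t. (\<Sum>i\<in>V. (s i)\<^sup>2) \<le> 1 \<Longrightarrow> (\<Sum>j\<in>V. (t j)\<^sup>2) \<le> 1 \<Longrightarrow>
    moment_norm p (signs V)
      (\<lambda>\<epsilon>. \<Sum>e\<in>V \<times> V. indicat_real E e * (s (fst e) * t (snd e)) * \<epsilon> e) \<le> B"
  shows "N_eps V E p \<le> B"
  unfolding N_eps_def edge_sum_eq
proof (rule cSUP_least)
  have "(\<lambda>_. 0, \<lambda>_. 0) \<in> {(s, t). L2_set s V \<le> 1 \<and> L2_set t V \<le> 1}"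
    by (simp add: L2_set_def)
  thus "{(s, t). L2_set s V \<le> 1 \<and> L2_set t V \<le> 1} \<noteq> {}" by blast
qed (use assms in \<open>auto simp: L2_set_le_1_iff\<close>)

lemma N_eps_geI:
  assumes V: "finite V" and p: "p > 0"
    and s: "(\<Sum>i\<in>V. (s i)\<^sup>2) \<le> 1" and t: "(\<Sum>j\<in>V. (t j)\<^sup>2) \<le> 1"
  shows "moment_norm p (signs V)
      (\<lambda>\<epsilon>. \<Sum>e\<in>V \<times> V. indicat_real E e * (s (fst e) * t (snd e)) * \<epsilon> e) \<le> N_eps V E p"
proof -
  \<comment> \<open>A member lies below a real supremum only if the set is bounded above. The crude
    bound \<open>card V\<close> comes from the degrees in \<open>E \<inter> V \<times> V\<close>, as
    \<open>E\<close> itself may leave \<open>V \<times> V\<close>.\<close>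
  have bdd: "moment_norm p (signs V)
      (\<lambda>\<epsilon>. \<Sum>e\<in>V \<times> V. indicat_real E e * (s (fst e) * t (snd e)) * \<epsilon> e) \<le> real (card V)"
    if "(\<Sum>i\<in>V. (s i)\<^sup>2) \<le> 1" "(\<Sum>j\<in>V. (t j)\<^sup>2) \<le> 1" for s t
  proof (rule moment_norm_signs_le[OF V p])
    fix \<epsilon> assume \<epsilon>: "\<epsilon> \<in> set_pmf (signs V)"
    have "(\<Sum>e\<in>V \<times> V. indicat_real E e * (s (fst e) * t (snd e)) * \<epsilon> e)
        = (\<Sum>e\<in>V \<times> V. indicat_real (E \<inter> V \<times> V) e * (s (fst e) * t (snd e)) * \<epsilon> e)"
      by (intro sum.cong) (auto simp: indicator_def)
    also have "\<bar>\<dots>\<bar> \<le> (\<Sum>e\<in>E \<inter> V \<times> V. \<bar>s (fst e) * t (snd e)\<bar>)"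
      by (intro sum_indicator_signs_le V \<epsilon>) auto
    also have "\<dots> \<le> sqrt (real (card V) * real (card V))"
      using that by (intro sum_le_sqrt_degrees V) (auto intro!: card_mono V)
    finally show "\<bar>\<Sum>e\<in>V \<times> V. indicat_real E e * (s (fst e) * t (snd e)) * \<epsilon> e\<bar> \<le> real (card V)"
      by simp
  qed auto
  have "bdd_above ((\<lambda>(s, t). moment_norm p (signs V)
      (\<lambda>\<epsilon>. \<Sum>e\<in>V \<times> V. indicat_real E e * (s (fst e) * t (snd e)) * \<epsilon> e))
      ` {(s, t). L2_set s V \<le> 1 \<and> L2_set t V \<le> 1})"
    using bdd by (intro bdd_aboveI[of _ "real (card V)"]) (auto simp: L2_set_le_1_iff)
  from cSUP_upper[OF _ this, of "(s, t)"] show ?thesis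
    using s t unfolding N_eps_def edge_sum_eq by (simp add: L2_set_le_1_iff)
qed

lemma card_eq_out_degree:
  assumes "finite A" "finite B" "R \<subseteq> A \<times> B" "\<And>a. a \<in> A \<Longrightarrow> card (R `` {a}) = \<alpha>"
  shows "card R = \<alpha> * card A"
proof -
  have "R = Sigma A (\<lambda>a. R `` {a})" using assms by auto
  hence "card R = card (Sigma A (\<lambda>a. R `` {a}))" by simp
  also have "\<dots> = (\<Sum>a\<in>A. card (R `` {a}))"
    using assms by (intro card_SigmaI) (auto intro: finite_subset[of _ B])
  finally show ?thesis using assms by simp
qed

text \<open>With the normalised indicators of \<open>A\<close> and \<open>B\<close> and all signs on
  the edges between them equal to 1, the form is the number of edges over
  \<open>sqrt (card A * card B)\<close>. The hypothesis on \<open>p\<close> makes forcing these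
  signs cheap, and the factor 2 is its price.\<close>

lemma N_eps_ge_biregular:
  assumes V: "finite V" and p: "p > 0" and AB: "A \<subseteq> V" "B \<subseteq> V" "A \<noteq> {}" "B \<noteq> {}"
    and out: "\<And>a. a \<in> A \<Longrightarrow> card ((E \<inter> A \<times> B) `` {a}) = \<alpha>"
    and inn: "\<And>b. b \<in> B \<Longrightarrow> card ((E \<inter> A \<times> B)\<inverse> `` {b}) = \<beta>"
    and few: "real (\<alpha> * card A) \<le> p"
  shows "sqrt (real \<alpha> * real \<beta>) \<le> 2 * N_eps V E p"
proof -
  let ?R = "E \<inter> A \<times> B"
  have fin: "finite A" "finite B" using AB V finite_subset by auto
  hence pos: "real (card A) > 0" "real (card B) > 0" using AB by (auto simp: card_gt_0_iff)
  have cR: "card ?R = \<alpha> * card A" using fin out by (intro card_eq_out_degree[of A B]) auto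
  have "card (?R\<inverse>) = \<beta> * card B" using fin inn by (intro card_eq_out_degree[of B A]) auto
  hence cR': "card ?R = \<beta> * card B" by simp
  define s where "s = (\<lambda>x. indicat_real A x / sqrt (card A))"
  define t where "t = (\<lambda>x. indicat_real B x / sqrt (card B))"
  have unit: "(\<Sum>x\<in>V. (indicat_real D x / sqrt (card D))\<^sup>2) \<le> 1" if "D \<subseteq> V" "card D > 0" for D
  proof -
    have "(\<Sum>x\<in>V. (indicat_real D x / sqrt (card D))\<^sup>2) = (\<Sum>x\<in>D. 1 / card D)"
      using that V by (intro sum.mono_neutral_cong_right) (auto simp: indicator_def power_divide)
    thus ?thesis using that by simp
  qed
  have s: "(\<Sum>x\<in>V. (s x)\<^sup>2) \<le> 1" and t: "(\<Sum>x\<in>V. (t x)\<^sup>2) \<le> 1"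
    unfolding s_def t_def using unit AB pos by auto
  have "sqrt (real \<alpha> * real \<beta>) / 2 \<le> moment_norm p (signs V)
      (\<lambda>\<epsilon>. \<Sum>e\<in>V \<times> V. indicat_real E e * (s (fst e) * t (snd e)) * \<epsilon> e)"
  proof (rule moment_norm_signs_ge[OF V p])
    show "?R \<subseteq> V \<times> V" using AB by auto
    show "real (card ?R) \<le> p" using few cR by simp
    fix \<epsilon> :: "'a \<times> 'a \<Rightarrow> real"
    assume \<epsilon>: "\<And>e. e \<in> ?R \<Longrightarrow> \<epsilon> e = 1"
    have "(\<Sum>e\<in>V \<times> V. indicat_real E e * (s (fst e) * t (snd e)) * \<epsilon> e)
        = (\<Sum>e\<in>?R. 1 / (sqrt (card A) * sqrt (card B)))"
      using V AB \<epsilon>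
      by (intro sum.mono_neutral_cong_right) (auto simp: indicator_def s_def t_def)
    also have "\<dots> = card ?R / sqrt (card A * card B)" by (simp add: real_sqrt_mult)
    also have "\<dots> = sqrt (real (card ?R) * real (card ?R) / (card A * card B))"
      by (simp add: real_sqrt_divide)
    \<comment> \<open>The edges are counted once from \<open>A\<close> and once from
      \<open>B\<close>, so that both cardinalities cancel.\<close>
    also have "real (card ?R) * real (card ?R) = real (\<alpha> * card A) * real (\<beta> * card B)"
      using cR cR' by simp
    also have "real (\<alpha> * card A) * real (\<beta> * card B) / (card A * card B) = real \<alpha> * real \<beta>"
      using pos by (simp add: field_simps)
    finally show "(\<Sum>e\<in>V \<times> V. indicat_real E e * (s (fst e) * t (snd e)) * \<epsilon> e)
      = sqrt (real \<alpha> * real \<beta>)" .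
  qed auto
  also have "\<dots> \<le> N_eps V E p" by (rule N_eps_geI[OF V p s t])
  finally show ?thesis by simp
qed

section \<open>Upper bounds for the cube\<close>

lemma N_cube_le_degree:
  assumes "p > 0"
  shows "N_cube d p \<le> real d"
  unfolding N_cube_def
proof (intro N_eps_leI moment_norm_signs_le finite_cube_verts assms)
  fix s t :: "(nat \<Rightarrow> nat) \<Rightarrow> real" and \<epsilon>
  assume s: "(\<Sum>i\<in>cube_verts d. (s i)\<^sup>2) \<le> 1" and t: "(\<Sum>j\<in>cube_verts d. (t j)\<^sup>2) \<le> 1"
    and \<epsilon>: "\<epsilon> \<in> set_pmf (signs (cube_verts d))"
  have "(\<Sum>e\<in>cube_edges d. \<bar>s (fst e) * t (snd e)\<bar>) \<le> sqrt (real d * real d)"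
    using s t by (intro sum_le_sqrt_degrees[OF finite_cube_verts cube_edges_subset])
      (auto simp: converse_cube_edges card_cube_neighbours)
  from order_trans[OF sum_indicator_signs_le[OF finite_cube_verts \<epsilon> cube_edges_subset] this]
  show "\<bar>\<Sum>e\<in>cube_verts d \<times> cube_verts d. indicat_real (cube_edges d) e * (s (fst e) * t (snd e)) * \<epsilon> e\<bar> \<le> real d"
    by simp
qed auto

text \<open>Without the edge indicator the squared coefficients sum to the product of the squared
  norms of \<open>s\<close> and \<open>t\<close>, so Khintchine's inequality applies with
  \<open>\<sigma> = 1\<close> and there is no bounded part.\<close>

lemma N_cube_le_sqrt:
  assumes "p \<ge> 1"
  shows "N_cube d p \<le> 6 * sqrt p"
  unfolding N_cube_def
proof (rule N_eps_leI)
  let ?V = "cube_verts d" and ?E = "cube_edges d"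
  fix s t :: "(nat \<Rightarrow> nat) \<Rightarrow> real"
  assume s: "(\<Sum>i\<in>?V. (s i)\<^sup>2) \<le> 1" and t: "(\<Sum>j\<in>?V. (t j)\<^sup>2) \<le> 1"
  have "(\<Sum>e\<in>?V \<times> ?V. (indicat_real ?E e * (s (fst e) * t (snd e)))\<^sup>2)
      \<le> (\<Sum>e\<in>?V \<times> ?V. (s (fst e))\<^sup>2 * (t (snd e))\<^sup>2)"
    by (intro sum_mono) (auto simp: indicator_def power_mult_distrib)
  also have "\<dots> = (\<Sum>i\<in>?V. (s i)\<^sup>2) * (\<Sum>j\<in>?V. (t j)\<^sup>2)"
    by (simp add: sum_product sum.cartesian_product case_prod_unfold)
  also have "\<dots> \<le> 1\<^sup>2" using mult_mono[OF s t] by (simp add: sum_nonneg)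
  finally have "moment_norm p (signs ?V)
      (\<lambda>\<epsilon>. \<Sum>e\<in>?V \<times> ?V. indicat_real ?E e * (s (fst e) * t (snd e)) * \<epsilon> e)
      \<le> 6 * (0 + sqrt p * 1)"
    using assms by (intro moment_norm_split_le[OF finite_cube_verts]) auto
  thus "moment_norm p (signs ?V)
      (\<lambda>\<epsilon>. \<Sum>e\<in>?V \<times> ?V. indicat_real ?E e * (s (fst e) * t (snd e)) * \<epsilon> e) \<le> 6 * sqrt p"
    by simp
qed

text \<open>The orientation \<open>R\<close> has out-degrees at most \<open>K\<close>, while
  in-degrees are only bounded by \<open>d\<close>. \<open>R\<close> and its converse together cover
  the edges inside \<open>W\<close>, and each contributes \<open>sqrt (K * d)\<close>.\<close>

lemma sum_subcube_edges_le:
  fixes s t :: "(nat \<Rightarrow> nat) \<Rightarrow> real"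
  assumes W: "W \<subseteq> cube_verts d" and K: "real (card W) \<le> 2 powr K" "K \<ge> 0"
    and s: "(\<Sum>i\<in>cube_verts d. (s i)\<^sup>2) \<le> 1" and t: "(\<Sum>j\<in>cube_verts d. (t j)\<^sup>2) \<le> 1"
  shows "(\<Sum>e\<in>cube_edges d \<inter> W \<times> W. \<bar>s (fst e) * t (snd e)\<bar>) \<le> 2 * sqrt (K * real d)"
proof -
  let ?V = "cube_verts d" and ?E = "cube_edges d"
  obtain R where R: "R \<subseteq> ?E \<inter> W \<times> W" "?E \<inter> W \<times> W \<subseteq> R \<union> R\<inverse>"
    "\<And>x. x \<in> W \<Longrightarrow> 2 ^ card (R `` {x}) \<le> card W"
    using cube_orientation[OF W] by auto
  have RV: "R \<subseteq> ?V \<times> ?V" "R\<inverse> \<subseteq> ?V \<times> ?V" using R(1) cube_edges_subset[of d] by auto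
  have fR: "finite R" using RV finite_cube_verts by (meson finite_SigmaI finite_subset)
  have fin: "finite (?E `` {x})" for x
    using cube_edges_subset[of d] by (intro finite_subset[OF _ finite_cube_verts[of d]]) auto
  have out: "real (card (R `` {x})) \<le> K" if "x \<in> ?V" for x
  proof (cases "x \<in> W")
    case True
    have "2 powr real (card (R `` {x})) = real (2 ^ card (R `` {x}))" by (simp add: powr_realpow)
    also have "\<dots> \<le> real (card W)" using R(3)[OF True] by (simp only: of_nat_le_iff)
    also have "\<dots> \<le> 2 powr K" by fact
    finally show ?thesis by simp
  next
    case False
    hence "R `` {x} = {}" using R(1) by auto
    thus ?thesis using K by simp
  qed
  have inn: "real (card (R\<inverse> `` {x})) \<le> real d" if "x \<in> ?V" for x
  proof -
    have "R\<inverse> `` {x} \<subseteq> ?E `` {x}" using R(1) sym_cube_edges[of d] by (auto simp: sym_def)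
    hence "card (R\<inverse> `` {x}) \<le> card (?E `` {x})" by (intro card_mono fin)
    thus ?thesis using card_cube_neighbours[OF that] by simp
  qed
  have "(\<Sum>e\<in>?E \<inter> W \<times> W. \<bar>s (fst e) * t (snd e)\<bar>) \<le> (\<Sum>e\<in>R \<union> R\<inverse>. \<bar>s (fst e) * t (snd e)\<bar>)"
    using R fR by (intro sum_mono2) auto
  also have "\<dots> \<le> (\<Sum>e\<in>R. \<bar>s (fst e) * t (snd e)\<bar>) + (\<Sum>e\<in>R\<inverse>. \<bar>s (fst e) * t (snd e)\<bar>)"
    using fR by (subst sum_Un) (auto intro!: sum_nonneg)
  also have "\<dots> \<le> sqrt (K * real d) + sqrt (real d * K)"
    using out inn K s t RV
    by (intro add_mono sum_le_sqrt_degrees[OF finite_cube_verts]) auto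
  finally show ?thesis by (simp add: mult.commute)
qed

text \<open>Markov's inequality for the counting measure and the weights
  \<open>(s i)\<^sup>2\<close>.\<close>

lemma card_large_entries_le:
  fixes s :: "'a \<Rightarrow> real"
  assumes "finite V" "(\<Sum>i\<in>V. (s i)\<^sup>2) \<le> 1" "p > 0"
  shows "real (card {i\<in>V. 1 / p \<le> (s i)\<^sup>2}) \<le> p"
proof -
  let ?I = "{i\<in>V. 1 / p \<le> (s i)\<^sup>2}"
  have "real (card ?I) * (1 / p) = (\<Sum>i\<in>?I. 1 / p)" by simp
  also have "\<dots> \<le> (\<Sum>i\<in>?I. (s i)\<^sup>2)" by (intro sum_mono) auto
  also have "\<dots> \<le> (\<Sum>i\<in>V. (s i)\<^sup>2)" using assms by (intro sum_mono2) auto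
  also have "\<dots> \<le> 1" by fact
  finally show ?thesis using assms(3) by (simp add: pos_divide_le_eq)
qed

text \<open>Edges between vertices carrying mass at least \<open>1 / p\<close> span a subgraph on at most \<open>2 p\<close>
  vertices, handled by its orientation; the others have coefficients of total square
  at most \<open>2 d / p\<close>, handled by Khintchine's inequality.\<close>

lemma N_cube_le_log:
  assumes p: "p \<ge> 2" and d: "d \<ge> 1"
  shows "N_cube d p \<le> 36 * sqrt (real d * ln p)"
  unfolding N_cube_def
proof (rule N_eps_leI)
  let ?V = "cube_verts d" and ?E = "cube_edges d"
  fix s t :: "(nat \<Rightarrow> nat) \<Rightarrow> real"
  assume s: "(\<Sum>i\<in>?V. (s i)\<^sup>2) \<le> 1" and t: "(\<Sum>j\<in>?V. (t j)\<^sup>2) \<le> 1"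
  let ?S = "\<lambda>\<epsilon>. \<Sum>e\<in>?V \<times> ?V. indicat_real ?E e * (s (fst e) * t (snd e)) * \<epsilon> e"
  define W where "W = {i\<in>?V. 1 / p \<le> (s i)\<^sup>2} \<union> {j\<in>?V. 1 / p \<le> (t j)\<^sup>2}"
  \<comment> \<open>\<open>W\<close> is a union of two sets of at most \<open>p\<close> vertices
    each.\<close>
  define K where "K = log 2 (2 * p)"
  define c where "c = (\<lambda>e. indicat_real (?E - W \<times> W) e * (s (fst e) * t (snd e)))"
  have WV: "W \<subseteq> ?V" by (auto simp: W_def)
  have "card W \<le> card {i\<in>?V. 1 / p \<le> (s i)\<^sup>2} + card {j\<in>?V. 1 / p \<le> (t j)\<^sup>2}"
    unfolding W_def by (rule card_Un_le)
  hence "real (card W) \<le> 2 * p"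
    using card_large_entries_le[OF finite_cube_verts s, of p]
      card_large_entries_le[OF finite_cube_verts t, of p] p by linarith
  hence cW: "real (card W) \<le> 2 powr K" using p by (simp add: K_def)
  have lnp: "ln p \<ge> 2 / 3" using p ln2_ge_two_thirds ln_mono[of 2 p] by linarith
  have K0: "K \<ge> 0" using p by (simp add: K_def)
  \<comment> \<open>Each summand is at most \<open>3 / 2 * ln p\<close>, because \<open>ln 2\<close>
    and \<open>ln p\<close> are at least \<open>2 / 3\<close>.\<close>
  have "K = 1 + ln p / ln 2" using p by (simp add: K_def log_def ln_mult add_divide_distrib)
  also have "ln p / ln 2 \<le> ln p / (2 / 3)"
    using lnp ln2_ge_two_thirds by (intro divide_left_mono) auto
  finally have K3: "K \<le> 3 * ln p" using lnp by simp
  have "(\<Sum>e\<in>?V \<times> ?V. (c e)\<^sup>2) = (\<Sum>e\<in>?E. (c e)\<^sup>2)"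
    using finite_cube_verts cube_edges_subset[of d]
    by (intro sum.mono_neutral_right) (auto simp: c_def indicator_def)
  also have "\<dots> \<le> (\<Sum>e\<in>?E. 1 / p * (s (fst e))\<^sup>2 + 1 / p * (t (snd e))\<^sup>2)"
  proof (rule sum_mono)
    fix e assume e: "e \<in> ?E"
    have nonneg: "0 \<le> 1 / p * (s (fst e))\<^sup>2" "0 \<le> 1 / p * (t (snd e))\<^sup>2" using p by auto
    show "(c e)\<^sup>2 \<le> 1 / p * (s (fst e))\<^sup>2 + 1 / p * (t (snd e))\<^sup>2"
    proof (cases "e \<in> W \<times> W")
      case True
      thus ?thesis using nonneg by (simp add: c_def)
    next
      case False
      \<comment> \<open>One endpoint lies outside \<open>W\<close>, where both \<open>s\<close> and
        \<open>t\<close> are small; hence the factor at that endpoint is small, whichever end it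
        is.\<close>
      hence "(s (fst e))\<^sup>2 \<le> 1 / p \<or> (t (snd e))\<^sup>2 \<le> 1 / p"
        using e cube_edges_subset[of d] by (cases e) (auto simp: W_def)
      moreover have "(c e)\<^sup>2 = (s (fst e))\<^sup>2 * (t (snd e))\<^sup>2"
        using False e by (simp add: c_def power_mult_distrib)
      ultimately show ?thesis
        using nonneg mult_right_mono[of "(s (fst e))\<^sup>2" "1 / p" "(t (snd e))\<^sup>2"]
          mult_left_mono[of "(t (snd e))\<^sup>2" "1 / p" "(s (fst e))\<^sup>2"] by fastforce
    qed
  qed
  also have "\<dots> = (\<Sum>e\<in>?E. 1 / p * (s (fst e))\<^sup>2) + (\<Sum>e\<in>?E. 1 / p * (t (snd e))\<^sup>2)"
    by (rule sum.distrib)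
  also have "\<dots> \<le> real d * (\<Sum>i\<in>?V. 1 / p * (s i)\<^sup>2) + real d * (\<Sum>j\<in>?V. 1 / p * (t j)\<^sup>2)"
    using p by (intro add_mono sum_fst_le[OF finite_cube_verts cube_edges_subset]
        sum_snd_le[OF finite_cube_verts cube_edges_subset])
      (auto simp: converse_cube_edges card_cube_neighbours)
  also have "\<dots> \<le> real d * (1 / p) + real d * (1 / p)"
    unfolding sum_distrib_left[symmetric] using s t p
    by (intro add_mono mult_left_mono) (auto simp: divide_right_mono)
  also have "\<dots> = (sqrt (2 * real d / p))\<^sup>2" using p by simp
  finally have c: "(\<Sum>e\<in>?V \<times> ?V. (c e)\<^sup>2) \<le> (sqrt (2 * real d / p))\<^sup>2" .
  have "moment_norm p (signs ?V) ?S \<le> 6 * (2 * sqrt (K * real d) + sqrt p * sqrt (2 * real d / p))"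
  proof (rule moment_norm_split_le[OF finite_cube_verts _ _ _ _ c])
    fix \<epsilon> assume \<epsilon>: "\<epsilon> \<in> set_pmf (signs ?V)"
    have "?S \<epsilon> - (\<Sum>e\<in>?V \<times> ?V. c e * \<epsilon> e)
        = (\<Sum>e\<in>?V \<times> ?V. indicat_real (?E \<inter> W \<times> W) e * (s (fst e) * t (snd e)) * \<epsilon> e)"
      unfolding sum_subtractf[symmetric]
    proof (rule sum.cong[OF refl])
      fix e
      have "indicat_real (?E - W \<times> W) e = indicat_real ?E e - indicat_real (?E \<inter> W \<times> W) e"
        unfolding indicator_def by (simp only: Diff_iff Int_iff) simp
      thus "indicat_real ?E e * (s (fst e) * t (snd e)) * \<epsilon> e - c e * \<epsilon> e
          = indicat_real (?E \<inter> W \<times> W) e * (s (fst e) * t (snd e)) * \<epsilon> e"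
        unfolding c_def by algebra
    qed
    also have "\<bar>\<dots>\<bar> \<le> (\<Sum>e\<in>?E \<inter> W \<times> W. \<bar>s (fst e) * t (snd e)\<bar>)"
      using WV by (intro sum_indicator_signs_le finite_cube_verts \<epsilon>) auto
    also have "\<dots> \<le> 2 * sqrt (K * real d)"
      by (rule sum_subcube_edges_le[OF WV cW K0 s t])
    finally show "\<bar>?S \<epsilon> - (\<Sum>e\<in>?V \<times> ?V. c e * \<epsilon> e)\<bar> \<le> 2 * sqrt (K * real d)" .
  qed (use p d K0 in auto)
  \<comment> \<open>The threshold \<open>1 / p\<close> is chosen for this cancellation of the
    Khintchine factor \<open>sqrt p\<close>.\<close>
  also have "sqrt p * sqrt (2 * real d / p) = sqrt (2 * real d)"
    using p by (simp add: real_sqrt_mult[symmetric])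
  \<comment> \<open>Both radicands are at most \<open>4 * (d * ln p)\<close>, which gives
    \<open>6 * (2 + 1) * 2 = 36\<close>.\<close>
  also have "6 * (2 * sqrt (K * real d) + sqrt (2 * real d))
      \<le> 6 * (2 * sqrt (4 * (real d * ln p)) + sqrt (4 * (real d * ln p)))"
  proof (intro mult_left_mono add_mono real_sqrt_le_mono)
    show "K * real d \<le> 4 * (real d * ln p)"
      using mult_right_mono[of K "4 * ln p" "real d"] K3 lnp by (simp add: mult_ac)
    show "2 * real d \<le> 4 * (real d * ln p)"
      using mult_left_mono[of 2 "4 * ln p" "real d"] lnp by (simp add: mult_ac)
  qed auto
  also have "\<dots> = 36 * sqrt (real d * ln p)" by (simp add: real_sqrt_mult)
  finally show "moment_norm p (signs ?V) ?S \<le> 36 * sqrt (real d * ln p)" .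
qed

section \<open>Layers of the cube\<close>

definition ones :: "nat \<Rightarrow> (nat \<Rightarrow> nat) \<Rightarrow> nat set" where
  "ones d x = {k. k < d \<and> x k = 1}"

definition layer :: "nat \<Rightarrow> nat \<Rightarrow> (nat \<Rightarrow> nat) set" where
  "layer d m = {x \<in> cube_verts d. card (ones d x) = m}"

lemma ones_subset: "ones d x \<subseteq> {..<d}"
  by (auto simp: ones_def)

lemma finite_ones: "finite (ones d x)"
  using finite_subset[OF ones_subset] by simp

lemma ones_flip:
  assumes "x \<in> cube_verts d" "k < d"
  shows "ones d (flip k x) = (if k \<in> ones d x then ones d x - {k} else insert k (ones d x))"
  using assms cube_verts_cases[OF assms] by (auto simp: ones_def flip_def)

lemma card_layer: "card (layer d m) = d choose m"
proof -
  \<comment> \<open>The restriction to \<open>{..<d}\<close> supplies the value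
    \<open>undefined\<close> elsewhere that membership in \<open>cube_verts\<close> demands.\<close>
  let ?ind = "\<lambda>X. \<lambda>k\<in>{..<d}. if k \<in> X then 1 else (0::nat)"
  have ones_ind: "ones d (?ind X) = X" if "X \<subseteq> {..<d}" for X
    using that by (auto simp: ones_def)
  have ind_ones: "?ind (ones d x) = x" if x: "x \<in> cube_verts d" for x
  proof (rule cube_verts_eqI[OF _ x])
    fix k assume k: "k < d"
    thus "?ind (ones d x) k = x k" using cube_verts_cases[OF x k] by (auto simp: ones_def)
  qed (auto simp: cube_verts_def)
  have "bij_betw (ones d) (layer d m) {X. X \<subseteq> {..<d} \<and> card X = m}"
  proof (rule bij_betw_byWitness[where f' = ?ind])
    show "\<forall>x\<in>layer d m. ?ind (ones d x) = x" using ind_ones by (auto simp: layer_def)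
    show "\<forall>X\<in>{X. X \<subseteq> {..<d} \<and> card X = m}. ones d (?ind X) = X" using ones_ind by blast
    show "ones d ` layer d m \<subseteq> {X. X \<subseteq> {..<d} \<and> card X = m}"
      using ones_subset by (auto simp: layer_def)
    have "?ind X \<in> cube_verts d" for X by (auto simp: cube_verts_def)
    thus "?ind ` {X. X \<subseteq> {..<d} \<and> card X = m} \<subseteq> layer d m"
      using ones_ind unfolding layer_def by (intro image_subsetI CollectI conjI) auto
  qed
  hence "card (layer d m) = card {X. X \<subseteq> {..<d} \<and> card X = m}" by (rule bij_betw_same_card)
  thus ?thesis by (simp add: n_subsets)
qed

text \<open>Going up from layer \<open>k\<close> means switching on one of \<open>d - k\<close>
  zeros, and going down from layer \<open>Suc k\<close> means switching off one of
  \<open>Suc k\<close> ones. So the graph between them is biregular.\<close>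

lemma N_cube_ge_layers:
  assumes k: "k < d" and p: "real (Suc k * (d choose Suc k)) \<le> p"
  shows "sqrt (real (d - k) * real (Suc k)) \<le> 2 * N_cube d p"
  unfolding N_cube_def
proof (rule N_eps_ge_biregular[where A = "layer d k" and B = "layer d (Suc k)"])
  let ?R = "cube_edges d \<inter> layer d k \<times> layer d (Suc k)"
  have ch: "d choose k > 0" "d choose Suc k > 0" using k by (auto simp: zero_less_binomial_iff)
  have "0 < real (Suc k * (d choose Suc k))"
    using ch(2) by (metis nat_0_less_mult_iff of_nat_0_less_iff zero_less_Suc)
  thus "0 < p" using p by linarith
  show "layer d k \<noteq> {}" "layer d (Suc k) \<noteq> {}"
    using ch card_layer[of d k] card_layer[of d "Suc k"] by (metis card.empty less_irrefl)+
  \<comment> \<open>The edge counts from below and from above both equal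
    \<open>d * ((d - 1) choose k)\<close>.\<close>
  show "real ((d - k) * card (layer d k)) \<le> p"
    using p unfolding card_layer binomial_absorb_comp binomial_absorption .
  show "card (?R `` {x}) = d - k" if "x \<in> layer d k" for x
  proof -
    have x: "x \<in> cube_verts d" "card (ones d x) = k" using that by (auto simp: layer_def)
    have "?R `` {x} = (\<lambda>l. flip l x) ` ({..<d} - ones d x)"
    proof (intro equalityI subsetI)
      fix y assume "y \<in> ?R `` {x}"
      then obtain l where l: "l < d" "y = flip l x" "card (ones d (flip l x)) = Suc k"
        by (auto simp: cube_edges_iff layer_def)
      moreover have "l \<notin> ones d x"
        using l x ones_flip[OF x(1) l(1)] finite_ones[of d x]
        by (auto simp: card_Diff_singleton_if split: if_splits)
      ultimately show "y \<in> (\<lambda>l. flip l x) ` ({..<d} - ones d x)" by auto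
    next
      fix y assume "y \<in> (\<lambda>l. flip l x) ` ({..<d} - ones d x)"
      then obtain l where l: "l < d" "l \<notin> ones d x" "y = flip l x" by auto
      thus "y \<in> ?R `` {x}"
        using that x ones_flip[OF x(1) l(1)] finite_ones[of d x] flip_in_cube_verts[OF x(1) l(1)]
        by (auto simp: cube_edges_iff layer_def)
    qed
    moreover have "inj_on (\<lambda>l. flip l x) ({..<d} - ones d x)"
      using inj_flip[OF x(1)] by (rule inj_on_subset) auto
    ultimately show ?thesis
      using x ones_subset[of d x] finite_ones[of d x] by (simp add: card_image card_Diff_subset)
  qed
  show "card (?R\<inverse> `` {y}) = Suc k" if "y \<in> layer d (Suc k)" for y
  proof -
    have y: "y \<in> cube_verts d" "card (ones d y) = Suc k" using that by (auto simp: layer_def)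
    have "?R\<inverse> `` {y} = (\<lambda>l. flip l y) ` ones d y"
    proof (intro equalityI subsetI)
      fix x assume "x \<in> ?R\<inverse> `` {y}"
      hence "(y, x) \<in> cube_edges d" "x \<in> layer d k"
        using sym_cube_edges[of d] by (auto simp: sym_def)
      then obtain l where l: "l < d" "x = flip l y" "card (ones d (flip l y)) = k"
        by (auto simp: cube_edges_iff layer_def)
      moreover have "l \<in> ones d y"
        using l y ones_flip[OF y(1) l(1)] finite_ones[of d y]
        by (auto split: if_splits)
      ultimately show "x \<in> (\<lambda>l. flip l y) ` ones d y" by auto
    next
      fix x assume "x \<in> (\<lambda>l. flip l y) ` ones d y"
      then obtain l where l: "l < d" "l \<in> ones d y" "x = flip l y" by (auto simp: ones_def)
      have "(y, x) \<in> cube_edges d" using l y by (auto simp: cube_edges_iff)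
      hence "(x, y) \<in> cube_edges d" using sym_cube_edges[of d] by (auto simp: sym_def)
      moreover have "x \<in> layer d k"
        using l y ones_flip[OF y(1) l(1)] finite_ones[of d y] flip_in_cube_verts[OF y(1) l(1)]
        by (auto simp: layer_def)
      ultimately show "x \<in> ?R\<inverse> `` {y}" using that by auto
    qed
    moreover have "inj_on (\<lambda>l. flip l y) (ones d y)"
      using inj_flip[OF y(1)] ones_subset by (rule inj_on_subset)
    ultimately show ?thesis using y by (simp add: card_image)
  qed
qed (auto simp: layer_def finite_cube_verts)

text \<open>A star with \<open>m\<close> leaves has out-degree \<open>m\<close> and in-degrees 1. It
  serves with \<open>m\<close> about \<open>p\<close> when \<open>p \<le> d\<close>, and with all
  \<open>d\<close> leaves for larger \<open>p\<close>.\<close>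

lemma N_cube_ge_star:
  assumes m: "m \<ge> 1" "m \<le> d" and p: "real m \<le> p"
  shows "sqrt (real m) \<le> 2 * N_cube d p"
proof -
  obtain z where z: "z \<in> cube_verts d"
    using card_cube_verts[of d] by (metis card.empty equals0I power_not_zero zero_neq_numeral)
  let ?B = "(\<lambda>k. flip k z) ` {..<m}"
  have inj: "inj_on (\<lambda>k. flip k z) {..<m}"
    using inj_flip[OF z] by (rule inj_on_subset) (use m in auto)
  have "sqrt (real m * real 1) \<le> 2 * N_eps (cube_verts d) (cube_edges d) p"
  proof (rule N_eps_ge_biregular[where A = "{z}" and B = ?B])
    have edge: "(z, y) \<in> cube_edges d" if "y \<in> ?B" for y
      using that z m unfolding cube_edges_iff by (meson imageE lessThan_iff order_less_le_trans)
    show "card ((cube_edges d \<inter> {z} \<times> ?B) `` {a}) = m" if "a \<in> {z}" for a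
    proof -
      have "(cube_edges d \<inter> {z} \<times> ?B) `` {a} = ?B" using that edge by auto
      thus ?thesis using inj by (simp add: card_image)
    qed
    show "card ((cube_edges d \<inter> {z} \<times> ?B)\<inverse> `` {b}) = 1" if "b \<in> ?B" for b
    proof -
      have "(cube_edges d \<inter> {z} \<times> ?B)\<inverse> `` {b} = {z}" using that edge[OF that] by auto
      thus ?thesis by simp
    qed
    show "?B \<subseteq> cube_verts d" using flip_in_cube_verts[OF z] m by auto
    show "?B \<noteq> {}" using m by (simp add: lessThan_empty_iff)
  qed (use z m p finite_cube_verts in auto)
  thus ?thesis by (simp add: N_cube_def)
qed

lemma N_cube_ge_degree:
  assumes d: "d \<ge> 1" and p: "real d * 2 ^ d \<le> p"
  shows "real d \<le> 2 * N_cube d p"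
proof -
  have E: "cube_edges d \<inter> cube_verts d \<times> cube_verts d = cube_edges d"
    using cube_edges_subset by blast
  have "sqrt (real d * real d) \<le> 2 * N_eps (cube_verts d) (cube_edges d) p"
  proof (rule N_eps_ge_biregular[where A = "cube_verts d" and B = "cube_verts d"])
    show "cube_verts d \<noteq> {}" "cube_verts d \<noteq> {}"
      using card_cube_verts[of d] by (metis card.empty power_not_zero zero_neq_numeral)+
    have "0 < real d * 2 ^ d" using d by simp
    thus "0 < p" using p by linarith
  qed (use p in \<open>auto simp: E converse_cube_edges card_cube_neighbours finite_cube_verts card_cube_verts\<close>)
  thus ?thesis by (simp add: N_cube_def)
qed

section \<open>Binomial and logarithmic estimates, choice of the layer\<close>

lemma binomial_le_exp:
  assumes m: "m \<ge> 1" "m \<le> d"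
  shows "real (d choose m) \<le> exp (real m * ln (exp 1 * real d / real m))"
proof -
  \<comment> \<open>One term of the expansion of \<open>(x + 1) ^ d\<close> is compared with the
    whole; this \<open>x\<close> makes \<open>exp x ^ d\<close> equal to
    \<open>exp m\<close>.\<close>
  define x where "x = real m / real d"
  have x: "x > 0" using m by (simp add: x_def)
  have "real (d choose m) * x ^ m \<le> (\<Sum>k\<le>d. real (d choose k) * x ^ k)"
    using m x by (intro member_le_sum[of m "{..d}" "\<lambda>k. real (d choose k) * x ^ k"]) auto
  also have "\<dots> = (x + 1) ^ d" by (simp add: binomial_ring)
  also have "\<dots> \<le> exp x ^ d" using x exp_ge_add_one_self[of x] by (intro power_mono) (auto simp: add.commute)
  also have "\<dots> = exp (real m)" using m by (simp add: x_def exp_of_nat_mult[symmetric])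
  finally have "real (d choose m) \<le> exp (real m) / x ^ m"
    using x by (simp add: pos_le_divide_eq)
  also have "\<dots> = exp (real m * (1 - ln x))"
    using x by (simp add: right_diff_distrib exp_diff exp_of_nat_mult)
  also have "1 - ln x = ln (exp 1 * real d / real m)"
    using m by (simp add: x_def ln_div ln_mult)
  finally show ?thesis .
qed

text \<open>Keeps the denominator of the lower bound away from 0: \<open>ln p\<close> is at most
  \<open>ln d + d * ln 2\<close>, hence at most \<open>3 / 2 * d\<close>, and
  \<open>3 / 2 \<le> exp (1 / 2)\<close>.\<close>

lemma log_ratio_ge_half:
  assumes d: "d \<ge> 1" and p: "p \<ge> 2" "p \<le> real d * 2 ^ d"
  shows "ln p \<le> 3 / 2 * real d" "ln (exp 1 * real d / ln p) \<ge> 1 / 2"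
proof -
  have "ln p \<le> ln (real d * 2 ^ d)" using p by (intro ln_mono) auto
  also have "\<dots> = ln (real d) + real d * ln 2" using d by (simp add: ln_mult ln_realpow)
  \<comment> \<open>Apply \<open>ln u \<le> u - 1\<close> at \<open>u = d / 2\<close> and use
    \<open>ln 2 < 1\<close>.\<close>
  also have "ln (real d) \<le> real d / 2"
    using ln_le_minus_one[of "real d / 2"] ln_2_less_1 d by (simp add: ln_div)
  also have "real d * ln 2 \<le> real d * 1" using ln_2_less_1 by (intro mult_left_mono) auto
  finally show L: "ln p \<le> 3 / 2 * real d" by simp
  have pos: "ln p > 0" using p by simp
  have "exp (1 / 2 :: real) * ln p \<le> exp (1 / 2) * (exp (1 / 2) * real d)"
    using L exp_ge_add_one_self[of "1 / 2 :: real"] mult_right_mono[of "3 / 2" "exp (1 / 2)" "real d"]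
    by (intro mult_left_mono) auto
  also have "\<dots> = exp 1 * real d" by (simp add: mult.assoc[symmetric] exp_add[symmetric])
  finally have "exp (1 / 2) \<le> exp 1 * real d / ln p" using pos by (simp add: pos_le_divide_eq)
  hence "ln (exp (1 / 2)) \<le> ln (exp 1 * real d / ln p)" by (intro ln_mono) auto
  thus "ln (exp 1 * real d / ln p) \<ge> 1 / 2" by simp
qed

text \<open>Let \<open>z\<close> be the upper bound imposed on \<open>m\<close>. The exponent
  \<open>m * ln (e * d / m)\<close> from \<open>binomial_le_exp\<close> is at most its value at
  \<open>z\<close>, which is at most \<open>14 / 64 * ln p\<close>. The linear factor
  \<open>m\<close> costs no more than that again, so the total stays below
  \<open>ln p\<close>.\<close>

lemma layer_edges_le:
  assumes d: "d \<ge> 1" and p: "p \<ge> 2" "p \<le> real d * 2 ^ d"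
    and m: "m \<ge> 1" "real m \<le> ln p / ln (exp 1 * real d / ln p) / 64"
  shows "real (m * (d choose m)) \<le> p" "2 * m \<le> d"
proof -
  define L where "L = ln p"
  define y where "y = ln (exp 1 * real d / L)"
  define z where "z = L / y / 64"
  define l where "l = ln (exp 1 * real d / z)"
  have L: "L > 0" "L \<le> 3 / 2 * real d" and y: "y \<ge> 1 / 2"
    using log_ratio_ge_half[OF d p] p by (auto simp: L_def y_def)
  have mz: "real m \<le> z" using m by (simp add: z_def L_def y_def)
  have "L / y \<le> L / (1 / 2)" using L y by (intro divide_left_mono) auto
  hence z: "z > 0" "z \<le> 3 / 64 * real d" using L y by (auto simp: z_def)
  show md: "2 * m \<le> d" using mz z by linarith
  have "exp 1 * real d / z = exp 1 * real d / L * (y * 2 ^ 6)"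
    using L y by (simp add: z_def field_simps)
  hence "l = ln (exp 1 * real d / L * (y * 2 ^ 6))" by (simp only: l_def)
  also have "\<dots> = y + (ln y + 6 * ln 2)"
    using L y d by (subst ln_mult, auto simp: y_def[symmetric]) (subst ln_mult, auto simp: ln_realpow[of 2 6, simplified])
  \<comment> \<open>Here \<open>ln y \<le> y - 1\<close>, and \<open>y \<ge> 1 / 2\<close> absorbs
    the remaining constant.\<close>
  also have "\<dots> \<le> 14 * y" using ln_le_minus_one[of y] y ln_2_less_1 by linarith
  finally have l14: "l \<le> 14 * y" .
  have "exp 1 \<le> exp 1 * real d / z" using z by (simp add: pos_le_divide_eq)
  hence "ln (exp 1) \<le> l" unfolding l_def by (intro ln_mono) auto
  hence l1: "l \<ge> 1" by simp
  \<comment> \<open>This proves the comparison of \<open>m\<close> with \<open>z\<close> without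
    derivatives: after bounding \<open>ln (z / m)\<close> by \<open>z / m - 1\<close> and
    multiplying by \<open>m\<close>, the excess \<open>z - m\<close> is at most
    \<open>(z - m) * l\<close> because \<open>l \<ge> 1\<close>.\<close>
  have "ln (exp 1 * real d / real m) = l + ln (z / real m)"
    using m z d by (simp add: l_def ln_div ln_mult)
  also have "\<dots> \<le> l + (z / real m - 1)" using m z ln_le_minus_one[of "z / real m"] by simp
  finally have "real m * ln (exp 1 * real d / real m) \<le> real m * (l + (z / real m - 1))"
    by (intro mult_left_mono) auto
  also have "\<dots> = real m * l + (z - real m) * 1" using m by (simp add: field_simps)
  also have "\<dots> \<le> real m * l + (z - real m) * l" using mz l1 by (intro add_left_mono mult_left_mono) auto
  also have "\<dots> = z * l" by (simp add: algebra_simps)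
  finally have e: "real m * ln (exp 1 * real d / real m) \<le> z * l" .
  \<comment> \<open>For the linear factor, which is bounded by \<open>exp m\<close>.\<close>
  have e': "real m \<le> z * l" using mult_mono[OF mz l1] z by simp
  have "real (m * (d choose m)) \<le> exp (real m) * exp (real m * ln (exp 1 * real d / real m))"
    unfolding of_nat_mult using m md binomial_le_exp[of m d]
      order_trans[OF _ exp_ge_add_one_self[of "real m"], of "real m"]
    by (intro mult_mono) auto
  also have "\<dots> \<le> exp (z * l) * exp (z * l)" using e e' by (intro mult_mono) auto
  also have "\<dots> = exp (2 * (z * l))" by (simp add: exp_add[symmetric])
  also have "\<dots> \<le> exp L"
  proof (subst exp_le_cancel_iff)
    have "2 * (z * l) \<le> 2 * (z * (14 * y))" using l14 z by (intro mult_left_mono) auto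
    also have "\<dots> = 28 / 64 * L" using y by (simp add: z_def)
    also have "\<dots> \<le> L" using L by simp
    finally show "2 * (z * l) \<le> L" .
  qed
  also have "exp L = p" using p by (simp add: L_def)
  finally show "real (m * (d choose m)) \<le> p" .
qed

lemma N_cube_ge_log:
  assumes d: "d \<ge> 1" and p: "p \<ge> 2" "real d \<le> p" "p \<le> real d * 2 ^ d"
  shows "sqrt (real d * (ln p / ln (exp 1 * real d / ln p))) \<le> 32 * N_cube d p"
proof -
  define x where "x = ln p / ln (exp 1 * real d / ln p)"
  show ?thesis
  proof (cases "x \<le> 64")
    \<comment> \<open>The layer index chosen below could be 0 here, but the full star already gives
      \<open>sqrt d\<close>, which is of the required order for bounded \<open>x\<close>.\<close>
    case True
    have "sqrt (real d * x) \<le> sqrt (real d * 64)" using True by (intro real_sqrt_le_mono mult_left_mono) auto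
    also have "\<dots> = 8 * sqrt (real d)" by (simp add: real_sqrt_mult)
    also have "\<dots> \<le> 32 * N_cube d p"
      using N_cube_ge_star[of d d p] d p real_sqrt_ge_zero[of "real d"] by linarith
    finally show ?thesis by (simp add: x_def)
  next
    case False
    define m where "m = nat \<lfloor>x / 64\<rfloor>"
    have "\<lfloor>x / 64\<rfloor> \<ge> 1" using False by (simp add: le_floor_iff)
    \<comment> \<open>As \<open>m \<ge> 1\<close>, rounding down loses at most a factor 2, whence
      \<open>x \<le> 128 * m\<close>.\<close>
    hence "real m = of_int \<lfloor>x / 64\<rfloor>" "m \<ge> 1" unfolding m_def by (simp, linarith)
    hence m: "m \<ge> 1" "real m \<le> x / 64" "x \<le> 128 * real m" by linarith+
    have count: "real (m * (d choose m)) \<le> p" "2 * m \<le> d"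
      using layer_edges_le[OF d p(1,3) m(1)] m(2) by (auto simp: x_def)
    have "sqrt (real (d - (m - 1)) * real (Suc (m - 1))) \<le> 2 * N_cube d p"
      using count m by (intro N_cube_ge_layers) auto
    hence "16 * sqrt (real (d - (m - 1)) * real m) \<le> 32 * N_cube d p" using m by simp
    \<comment> \<open>From \<open>2 * m \<le> d\<close>, the up-degree \<open>d - (m - 1)\<close> is
      at least \<open>d / 2\<close>. The two losses combine to
      \<open>2 * 128 = 16\<^sup>2\<close>.\<close>
    moreover have "real d * x \<le> (2 * real (d - (m - 1))) * (128 * real m)"
      using m count False by (intro mult_mono) auto
    hence "sqrt (real d * x) \<le> sqrt (256 * (real (d - (m - 1)) * real m))"
      by (intro real_sqrt_le_mono) simp
    hence "sqrt (real d * x) \<le> 16 * sqrt (real (d - (m - 1)) * real m)"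
      by (simp add: real_sqrt_mult)
    ultimately show ?thesis by (simp add: x_def)
  qed
qed

theorem proposition3p3:
  "\<exists>C::real. C > 0 \<and> (\<forall>(d::nat) (p::real). d \<ge> 1 \<longrightarrow>
     (2 \<le> p \<and> p \<le> real d \<longrightarrow>
        N_cube d p \<le> C * sqrt p \<and> sqrt p \<le> C * N_cube d p) \<and>
     (p \<ge> real d * 2 ^ d \<longrightarrow>
        N_cube d p \<le> C * real d \<and> real d \<le> C * N_cube d p) \<and>
     (max (real d) 2 \<le> p \<and> p \<le> real d * 2 ^ d \<longrightarrow>
        sqrt (real d * (ln p / ln (exp 1 * real d / ln p))) \<le> C * N_cube d p \<and>
        N_cube d p \<le> C * sqrt (real d * ln p)))"
\<comment> \<open>The constant of \<open>N_cube_le_log\<close>, the largest of those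
  obtained.\<close>
proof (intro exI[of _ "36::real"] conjI allI impI)
  fix d :: nat and p :: real
  assume d: "d \<ge> 1"
  {
    assume p: "2 \<le> p \<and> p \<le> real d"
    show "N_cube d p \<le> 36 * sqrt p"
      using N_cube_le_sqrt[of p d] p real_sqrt_ge_zero[of p] by linarith
    \<comment> \<open>The largest star with at most \<open>p\<close> edges; it exists in the cube
      because \<open>p \<le> d\<close>.\<close>
    define m where "m = nat \<lfloor>p\<rfloor>"
    have m: "m \<ge> 1" "real m \<le> p" "m \<le> d" "p \<le> 4 * real m" using p unfolding m_def by linarith+
    have "sqrt p \<le> sqrt (4 * real m)" using m by simp
    also have "\<dots> = 2 * sqrt (real m)" by (simp add: real_sqrt_mult)
    finally show "sqrt p \<le> 36 * N_cube d p"
      using N_cube_ge_star[OF m(1,3,2)] real_sqrt_ge_zero[of "real m"] by linarith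
  next
    assume p: "p \<ge> real d * 2 ^ d"
    moreover have "real d * 2 ^ d > 0" using d by simp
    ultimately have "p > 0" by linarith
    thus "N_cube d p \<le> 36 * real d" using N_cube_le_degree[of p d] by linarith
    show "real d \<le> 36 * N_cube d p" using N_cube_ge_degree[OF d p] by linarith
  next
    assume "max (real d) 2 \<le> p \<and> p \<le> real d * 2 ^ d"
    hence p: "p \<ge> 2" "real d \<le> p" "p \<le> real d * 2 ^ d" by auto
    \<comment> \<open>Allows the constant 32 to be raised to 36.\<close>
    have "N_cube d p \<ge> 0"
      using N_cube_ge_star[of d d p] d p real_sqrt_ge_zero[of "real d"] by linarith
    thus "sqrt (real d * (ln p / ln (exp 1 * real d / ln p))) \<le> 36 * N_cube d p"
      using N_cube_ge_log[OF d p] by linarith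
    show "N_cube d p \<le> 36 * sqrt (real d * ln p)" by (rule N_cube_le_log[OF p(1) d])
  }
qed simp

end
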